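(* Let $K$ be a nonnegative integer and $\alpha\in\mathbb{R}$ a stepsize. Let $x^{(K)}$ denote the output after $K$ iterations of gradient descent $x^{(k+1)} = x^{(k)} - \alpha \nabla g(x^{(k)})$ from a given starting point $x^{(0)}\in\mathbb{R}^d$, and let $\Phi(x) = \frac12 x^T A(x^{(K)}) x - \nabla f(x^{(K)})^T x$ for $x\in\mathbb{R}^d$. Let $h^{(K)}\in\mathbb{R}^n$ be the gradient estimate obtained after $K$ iterations of the inexact automatic differentiation iteration $$h^{(k+1)} = h^{(k)} - \alpha B(x^{(K)})^T \tilde{x}^{(k)}, \qquad \tilde{x}^{(k+1)} = \tilde{x}^{(k)} - \alpha A(x^{(K)}) \tilde{x}^{(k)}, \qquad k=0,\dots,K-1,$$ initialized with $\tilde{x}^{(0)} = \nabla f(x^{(K)})$ and $h^{(0)} = 0$. Then $$h^{(K)} = -B(x^{(K)})^T q^{(K)},$$ where $q^{(0)} = 0\in\mathbb{R}^d$ and $$q^{(k+1)} = q^{(k)} - \alpha \nabla \Phi(q^{(k)}), \qquad k=0,\dots,K-1.$$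
   Context: Setting: $g:\mathbb{R}^d\times\mathbb{R}^n\to\mathbb{R}$, $(y,\theta)\mapsto g(y,\theta)$, is the lower-level objective of a bilevel problem, twice continuously differentiable in $y$ and such that the mixed derivative below exists; $f:\mathbb{R}^d\to\mathbb{R}$ is a differentiable upper-level function. The parameter $\theta\in\mathbb{R}^n$ is fixed and dropped from the notation: $\nabla g(y) := \partial_y g(y,\theta)\in\mathbb{R}^d$ is the gradient in $y$; $A(y) := \partial_{yy} g(y,\theta)\in\mathbb{R}^{d\times d}$ is the (symmetric) Hessian in $y$; and $B(y) := \partial_y\partial_\theta g(y,\theta)\in\mathbb{R}^{d\times n}$ is the Jacobian of $\partial_y g$ with respect to $\theta$, i.e. $[B(y)]_{j,k} = \partial^2 g(y,\theta)/(\partial y_j\partial\theta_k)$. *)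

theory Defs
  imports "HOL-Analysis.Analysis"
begin

definition gradient :: "('a::real_inner \<Rightarrow> real) \<Rightarrow> 'a \<Rightarrow> 'a"
  where "gradient \<phi> y = (THE D. GDERIV \<phi> y :> D)"

definition hessian :: "(real ^ 'd \<Rightarrow> real) \<Rightarrow> real ^ 'd \<Rightarrow> real ^ 'd ^ 'd"
  where "hessian \<phi> y = jacobian (gradient \<phi>) (at y)"

definition twice_continuously_differentiable :: "(real ^ 'd \<Rightarrow> real) \<Rightarrow> bool"
  where "twice_continuously_differentiable \<phi> \<longleftrightarrow>
    (\<forall>y. \<phi> differentiable (at y)) \<and>
    (\<forall>y. gradient \<phi> differentiable (at y)) \<and>
    continuous_on UNIV (hessian \<phi>)"

text \<open>
  The mixed second derivative at \<open>(y, \<theta>)\<close> is the \<open>d \<times> n\<close> matrix whose entry in row \<open>j\<close> and column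
  \<open>k\<close> is the partial derivative with respect to the \<open>k\<close>-th coordinate of \<open>\<theta>\<close> of the \<open>j\<close>-th component
  of the gradient in \<open>y\<close>. It is defined as soon as these partial derivatives exist; if the gradient
  in \<open>y\<close> is totally differentiable in \<open>\<theta>\<close>, it is the library's \<^const>\<open>jacobian\<close>
  (lemma \<open>mixed_derivative_eq_jacobian\<close>).
\<close>

definition mixed_derivative_exists ::
  "(real ^ 'd \<Rightarrow> real ^ 'n \<Rightarrow> real) \<Rightarrow> real ^ 'd \<Rightarrow> real ^ 'n \<Rightarrow> bool"
  where "mixed_derivative_exists g y \<theta> \<longleftrightarrow>
    (\<forall>j k. (\<lambda>t. gradient (\<lambda>y. g y (\<theta> + t *\<^sub>R axis k 1)) y $ j) field_differentiable (at 0))"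

definition mixed_derivative ::
  "(real ^ 'd \<Rightarrow> real ^ 'n \<Rightarrow> real) \<Rightarrow> real ^ 'd \<Rightarrow> real ^ 'n \<Rightarrow> real ^ 'n ^ 'd"
  where "mixed_derivative g y \<theta> =
    (\<chi> j k. deriv (\<lambda>t. gradient (\<lambda>y. g y (\<theta> + t *\<^sub>R axis k 1)) y $ j) 0)"

lemma gradient_eqI:
  assumes "GDERIV \<phi> y :> D"
  shows "gradient \<phi> y = D"
  unfolding gradient_def
proof (rule the_equality)
  show "GDERIV \<phi> y :> D" by (rule assms)
next
  fix E assume "GDERIV \<phi> y :> E"
  then have "(\<lambda>h. h \<bullet> E) = (\<lambda>h. h \<bullet> D)"
    using assms has_derivative_unique unfolding gderiv_def by blast
  then show "E = D" by (metis inner_commute vector_eq_ldot)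
qed

lemma mixed_derivative_eq_jacobian:
  fixes g :: "real ^ 'd \<Rightarrow> real ^ 'n \<Rightarrow> real"
  assumes "(\<lambda>\<theta>. gradient (\<lambda>y. g y \<theta>) y) differentiable (at \<theta>)"
  shows "mixed_derivative_exists g y \<theta>"
    and "mixed_derivative g y \<theta> = jacobian (\<lambda>\<theta>. gradient (\<lambda>y. g y \<theta>) y) (at \<theta>)"
proof -
  let ?G = "\<lambda>\<theta>. gradient (\<lambda>y. g y \<theta>) y"
  let ?J = "jacobian ?G (at \<theta>)"
  have G: "(?G has_derivative (\<lambda>h. ?J *v h)) (at \<theta>)"
    using assms jacobian_works by blast
  have D: "((\<lambda>t. ?G (\<theta> + t *\<^sub>R axis k 1) $ j) has_field_derivative ?J $ j $ k) (at 0)" for j k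
  proof -
    have "((\<lambda>t::real. \<theta> + t *\<^sub>R axis k 1) has_derivative (\<lambda>t. t *\<^sub>R axis k 1)) (at 0)"
      by (auto intro!: derivative_eq_intros)
    then have "((\<lambda>t. ?G (\<theta> + t *\<^sub>R axis k 1)) has_derivative (\<lambda>t. ?J *v (t *\<^sub>R axis k 1))) (at 0)"
      using has_derivative_compose[of "\<lambda>t::real. \<theta> + t *\<^sub>R axis k 1" _ 0 UNIV ?G] G by auto
    then have "((\<lambda>t. ?G (\<theta> + t *\<^sub>R axis k 1) $ j) has_derivative
        (\<lambda>t. (?J *v (t *\<^sub>R axis k 1)) $ j)) (at 0)"
      by (rule bounded_linear.has_derivative[OF bounded_linear_vec_nth])
    moreover have "(?J *v (t *\<^sub>R axis k 1)) $ j = ?J $ j $ k * t" for t :: real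
      by (simp add: scaleR_matrix_vector_assoc[symmetric] matrix_vector_mult_scaleR
          matrix_vector_mult_basis column_def)
    ultimately show ?thesis unfolding has_field_derivative_def by simp
  qed
  show "mixed_derivative_exists g y \<theta>"
    unfolding mixed_derivative_exists_def field_differentiable_def using D by blast
  show "mixed_derivative g y \<theta> = ?J"
    unfolding mixed_derivative_def by (simp add: vec_eq_iff DERIV_imp_deriv[OF D])
qed

end

theory Submission
  imports Defs
begin

text \<open>
  With \<open>b = \<nabla>f(x\<^sup>K)\<close>, \<open>A = A(x\<^sup>K)\<close> and \<open>B = B(x\<^sup>K)\<close>, the vectors \<open>b - A q\<^sup>k\<close> satisfy the recursion
  that defines the adjoint iterates, so they are the adjoint iterates; hence both \<open>h\<^sup>k\<close> and
  \<open>- B\<^sup>T q\<^sup>k\<close> accumulate \<open>- \<alpha> B\<^sup>T (b - A q\<^sup>k)\<close>. The analytic input is \<open>\<nabla>\<Phi>(z) = A z - b\<close>, which needs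
  the symmetry of the Hessian.
\<close>

text \<open>By Riesz representation: a derivative \<open>L\<close> into the reals is the inner
  product with the vector \<open>adjoint L 1\<close>. This makes the description in
  \<open>gradient\<close> denote an actual gradient.\<close>

lemma has_gderiv_gradient:
  fixes \<phi> :: "'a::euclidean_space \<Rightarrow> real"
  assumes "\<phi> differentiable (at y)"
  shows "GDERIV \<phi> y :> gradient \<phi> y"
proof -
  from assms obtain L where L: "(\<phi> has_derivative L) (at y)"
    unfolding differentiable_def by blast
  then interpret bounded_linear L by (rule has_derivative_bounded_linear)
  have "L = (\<lambda>h. h \<bullet> adjoint L 1)"
    using adjoint_works[OF linear_axioms, of _ 1] by (simp add: fun_eq_iff)
  with L have "GDERIV \<phi> y :> adjoint L 1"
    unfolding gderiv_def by metis
  then show ?thesis by (simp add: gradient_eqI)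
qed

text \<open>
  The second difference of \<open>\<phi>\<close> along \<open>u\<close> and \<open>v\<close> is symmetric in \<open>u\<close> and \<open>v\<close>. By the mean value
  theorem in direction \<open>u\<close> it is approximately \<open>t\<^sup>2 (u \<bullet> G' v)\<close>.
\<close>

lemma second_difference_approx:
  fixes \<phi> :: "'a::euclidean_space \<Rightarrow> real"
  assumes G: "\<And>z. GDERIV \<phi> z :> G z"
    and lin: "linear G'"
    and approx: "\<And>w. norm w < d \<Longrightarrow> norm (G (y + w) - G y - G' w) \<le> e * norm w"
    and e: "0 \<le> e"
    and t: "0 < t" "t * (norm u + norm v) < d"
  shows "\<bar>\<phi> (y + t *\<^sub>R u + t *\<^sub>R v) - \<phi> (y + t *\<^sub>R u) - \<phi> (y + t *\<^sub>R v) + \<phi> y - t\<^sup>2 * (u \<bullet> G' v)\<bar>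
    \<le> 2 * e * t\<^sup>2 * (norm u + norm v)\<^sup>2"
proof -
  \<comment> \<open>The second difference equals \<open>\<psi> t - \<psi> 0\<close>, so a
    one-variable mean value theorem applies to it.\<close>
  define \<psi> where "\<psi> s = \<phi> (y + s *\<^sub>R u + t *\<^sub>R v) - \<phi> (y + s *\<^sub>R u)" for s
  define R where "R w = G (y + w) - G y - G' w" for w
  define N where "N = norm u + norm v"
  have line: "((\<lambda>s. \<phi> (c + s *\<^sub>R u)) has_real_derivative u \<bullet> G (c + s *\<^sub>R u)) (at s)" for c s
  proof -
    have "((\<lambda>s::real. c + s *\<^sub>R u) has_derivative (\<lambda>s. s *\<^sub>R u)) (at s)"
      by (auto intro!: derivative_eq_intros)
    from has_derivative_compose[OF this G[unfolded gderiv_def]]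
    show ?thesis by (simp add: has_field_derivative_def mult_commute_abs)
  qed
  have deriv: "(\<psi> has_real_derivative u \<bullet> (G (y + s *\<^sub>R u + t *\<^sub>R v) - G (y + s *\<^sub>R u))) (at s)" for s
    using DERIV_diff[OF line[of "y + t *\<^sub>R v" s] line[of y s]]
    unfolding \<psi>_def by (simp add: inner_diff_right add_ac)
  then obtain \<xi> where \<xi>: "0 < \<xi>" "\<xi> < t"
    and mv: "\<psi> t - \<psi> 0 = t * (u \<bullet> (G (y + \<xi> *\<^sub>R u + t *\<^sub>R v) - G (y + \<xi> *\<^sub>R u)))"
    using MVT2[OF t(1) deriv] by auto
  let ?p = "\<xi> *\<^sub>R u + t *\<^sub>R v" and ?q = "\<xi> *\<^sub>R u"
  have "\<xi> * norm u \<le> t * norm u"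
    using \<xi> by (intro mult_right_mono) auto
  then have q: "norm ?q \<le> t * N" and p: "norm ?p \<le> t * N"
    using \<xi> t(1) norm_triangle_ineq[of ?q "t *\<^sub>R v"]
    by (auto simp: N_def distrib_left intro: add_increasing2)
  have R: "norm (R w) \<le> e * (t * N)" if "norm w \<le> t * N" for w
    using approx[of w] that t(2) mult_left_mono[OF that e] unfolding R_def N_def by linarith
  \<comment> \<open>Both gradients are expanded at the same point \<open>y\<close>. The terms in
    \<open>\<xi>\<close> cancel by linearity of \<open>G'\<close>, so the unknown
    \<open>\<xi>\<close> survives only in the remainders.\<close>
  have "G (y + \<xi> *\<^sub>R u + t *\<^sub>R v) - G (y + \<xi> *\<^sub>R u) = t *\<^sub>R G' v + (R ?p - R ?q)"
    by (simp add: R_def linear_add[OF lin] linear_scale[OF lin] add.assoc)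
  then have "\<psi> t - \<psi> 0 - t\<^sup>2 * (u \<bullet> G' v) = t * (u \<bullet> (R ?p - R ?q))"
    unfolding mv by (simp only: inner_add_right) (simp add: power2_eq_square algebra_simps)
  also have "\<bar>\<dots>\<bar> \<le> t * (N * (2 * e * (t * N)))"
  proof -
    have "norm (R ?p - R ?q) \<le> 2 * e * (t * N)"
      using norm_triangle_ineq4[of "R ?p" "R ?q"] R[OF p] R[OF q] by linarith
    then have "norm u * norm (R ?p - R ?q) \<le> N * (2 * e * (t * N))"
      by (intro mult_mono) (auto simp: N_def)
    then have "\<bar>u \<bullet> (R ?p - R ?q)\<bar> \<le> N * (2 * e * (t * N))"
      using Cauchy_Schwarz_ineq2[of u "R ?p - R ?q"] by linarith
    then show ?thesis using t(1) by (simp add: abs_mult)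
  qed
  finally show ?thesis
    by (simp add: \<psi>_def N_def power2_eq_square algebra_simps)
qed

text \<open>One second difference is approximated by both
  \<open>t\<^sup>2 * (u \<bullet> G' v)\<close> and \<open>t\<^sup>2 * (v \<bullet> G' u)\<close>.
  Dividing by \<open>t\<^sup>2\<close> bounds their gap by a multiple of an arbitrary
  \<open>e\<close>.\<close>

lemma second_derivative_symmetric:
  fixes \<phi> :: "'a::euclidean_space \<Rightarrow> real"
  assumes G: "\<And>z. GDERIV \<phi> z :> G z"
    and G': "(G has_derivative G') (at y)"
  shows "u \<bullet> G' v = v \<bullet> G' u"
proof -
  have lin: "linear G'" using G' by (rule has_derivative_linear)
  define N where "N = norm u + norm v"
  have bound: "\<bar>u \<bullet> G' v - v \<bullet> G' u\<bar> \<le> 4 * e * N\<^sup>2" if e: "0 < e" for e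
  proof -
    obtain d where d: "0 < d"
      and near: "\<And>z. norm (z - y) < d \<Longrightarrow> norm (G z - G y - G' (z - y)) \<le> e * norm (z - y)"
      using G' e unfolding has_derivative_at_alt by blast
    have approx: "\<And>w. norm w < d \<Longrightarrow> norm (G (y + w) - G y - G' w) \<le> e * norm w"
      using near[of "y + _"] by simp
    \<comment> \<open>The summand 1 gives \<open>t * N < d\<close> strictly and keeps the quotient
      meaningful when \<open>u\<close> and \<open>v\<close> are both zero.\<close>
    define t where "t = d / (N + 1)"
    have N: "0 \<le> N" by (simp add: N_def)
    have t: "0 < t" "t * N < d"
      using d N by (simp_all add: t_def field_simps)
    let ?D = "\<phi> (y + t *\<^sub>R u + t *\<^sub>R v) - \<phi> (y + t *\<^sub>R u) - \<phi> (y + t *\<^sub>R v) + \<phi> y"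
    have "\<bar>?D - t\<^sup>2 * (u \<bullet> G' v)\<bar> \<le> 2 * e * t\<^sup>2 * N\<^sup>2"
      using second_difference_approx[OF G lin approx, where t = t and u = u and v = v and d = d] e t
      by (simp add: N_def)
    moreover have "\<bar>?D - t\<^sup>2 * (v \<bullet> G' u)\<bar> \<le> 2 * e * t\<^sup>2 * N\<^sup>2"
      using second_difference_approx[OF G lin approx, where t = t and u = v and v = u and d = d] e t
      by (simp add: N_def algebra_simps)
    ultimately have "\<bar>t\<^sup>2 * (u \<bullet> G' v) - t\<^sup>2 * (v \<bullet> G' u)\<bar> \<le> t\<^sup>2 * (4 * e * N\<^sup>2)"
      by (simp add: mult_ac)
    then have "t\<^sup>2 * \<bar>u \<bullet> G' v - v \<bullet> G' u\<bar> \<le> t\<^sup>2 * (4 * e * N\<^sup>2)"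
      by (simp add: abs_mult flip: right_diff_distrib)
    then show ?thesis using t(1) by simp
  qed
  have "\<bar>u \<bullet> G' v - v \<bullet> G' u\<bar> \<le> 0"
  proof (rule field_le_epsilon)
    fix e :: real assume e: "0 < e"
    have N: "0 < 4 * N\<^sup>2 + 1" by (simp add: add_nonneg_pos)
    \<comment> \<open>The bound is applied with \<open>e\<close> rescaled so that the factor
      \<open>4 * N\<^sup>2\<close> is absorbed, also when \<open>N\<close> is zero.\<close>
    then have "\<bar>u \<bullet> G' v - v \<bullet> G' u\<bar> \<le> 4 * (e / (4 * N\<^sup>2 + 1)) * N\<^sup>2"
      using e by (intro bound divide_pos_pos)
    also have "\<dots> \<le> e"
      using N e by (simp add: field_simps)
    finally show "\<bar>u \<bullet> G' v - v \<bullet> G' u\<bar> \<le> 0 + e" by simp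
  qed
  then show ?thesis by simp
qed

lemma inner_hessian_symmetric:
  assumes "twice_continuously_differentiable \<phi>"
  shows "u \<bullet> (hessian \<phi> y *v v) = v \<bullet> (hessian \<phi> y *v u)"
proof (rule second_derivative_symmetric)
  show "GDERIV \<phi> z :> gradient \<phi> z" for z
    using assms by (simp add: twice_continuously_differentiable_def has_gderiv_gradient)
  show "(gradient \<phi> has_derivative (\<lambda>w. hessian \<phi> y *v w)) (at y)"
    using assms by (simp add: twice_continuously_differentiable_def hessian_def flip: jacobian_works)
qed

text \<open>The product rule yields half of
  \<open>y \<bullet> (M *v h) + h \<bullet> (M *v y)\<close>; symmetry merges the two terms into
  \<open>h \<bullet> (M *v y)\<close>.\<close>

lemma gradient_quadratic:
  fixes M :: "real ^ 'd ^ 'd"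
  assumes sym: "\<And>u v. u \<bullet> (M *v v) = v \<bullet> (M *v u)"
  shows "gradient (\<lambda>z. 1 / 2 * (z \<bullet> (M *v z)) - b \<bullet> z) y = M *v y - b"
proof (rule gradient_eqI)
  have "((\<lambda>z. 1 / 2 * (z \<bullet> (M *v z)) - b \<bullet> z) has_derivative
      (\<lambda>h. 1 / 2 * (y \<bullet> (M *v h) + h \<bullet> (M *v y)) - b \<bullet> h)) (at y)"
    by (auto intro!: derivative_eq_intros
        bounded_linear.has_derivative[OF matrix_vector_mul_bounded_linear])
  then show "GDERIV (\<lambda>z. 1 / 2 * (z \<bullet> (M *v z)) - b \<bullet> z) y :> M *v y - b"
    unfolding gderiv_def using sym[of y] by (simp add: inner_diff_right inner_commute)
qed

theorem theorem7:
  fixes g :: "real ^ 'd \<Rightarrow> real ^ 'n \<Rightarrow> real"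
    and f :: "real ^ 'd \<Rightarrow> real"
    and \<theta> :: "real ^ 'n"
    and \<alpha> :: real
    and K :: nat
    and x xt q :: "nat \<Rightarrow> real ^ 'd"
    and h :: "nat \<Rightarrow> real ^ 'n"
    and A :: "real ^ 'd \<Rightarrow> real ^ 'd ^ 'd"
    and B :: "real ^ 'd \<Rightarrow> real ^ 'n ^ 'd"
    and \<Phi> :: "real ^ 'd \<Rightarrow> real"
  assumes g_C2: "\<And>\<theta>'. twice_continuously_differentiable (\<lambda>y. g y \<theta>')"
    and g_mixed: "\<And>y. mixed_derivative_exists g y \<theta>"
    and f_diff: "\<And>y. f differentiable (at y)"
    and A: "\<And>y. A y = hessian (\<lambda>y. g y \<theta>) y"
    and B: "\<And>y. B y = mixed_derivative g y \<theta>"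
    and x_step: "\<And>k. k < K \<Longrightarrow> x (Suc k) = x k - \<alpha> *\<^sub>R gradient (\<lambda>y. g y \<theta>) (x k)"
    and \<Phi>: "\<And>z. \<Phi> z = 1 / 2 * (z \<bullet> (A (x K) *v z)) - gradient f (x K) \<bullet> z"
    and xt_0: "xt 0 = gradient f (x K)"
    and xt_step: "\<And>k. k < K \<Longrightarrow> xt (Suc k) = xt k - \<alpha> *\<^sub>R (A (x K) *v xt k)"
    and h_0: "h 0 = 0"
    and h_step: "\<And>k. k < K \<Longrightarrow> h (Suc k) = h k - \<alpha> *\<^sub>R (transpose (B (x K)) *v xt k)"
    and q_0: "q 0 = 0"
    and q_step: "\<And>k. k < K \<Longrightarrow> q (Suc k) = q k - \<alpha> *\<^sub>R gradient \<Phi> (q k)"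
  shows "h K = - (transpose (B (x K)) *v q K)"
proof -
  let ?M = "A (x K)" and ?b = "gradient f (x K)" and ?C = "transpose (B (x K))"
  have sym: "u \<bullet> (?M *v v) = v \<bullet> (?M *v u)" for u v
    unfolding A using g_C2 by (rule inner_hessian_symmetric)
  have "\<Phi> = (\<lambda>z. 1 / 2 * (z \<bullet> (?M *v z)) - ?b \<bullet> z)"
    using \<Phi> by blast
  then have grad: "gradient \<Phi> z = ?M *v z - ?b" for z
    by (simp only: gradient_quadratic[OF sym])
  have "k \<le> K \<Longrightarrow> xt k = ?b - ?M *v q k \<and> h k = - (?C *v q k)" for k
  proof (induction k)
    case 0
    then show ?case by (simp add: xt_0 h_0 q_0)
  next
    case (Suc k)
    then have k: "k < K" and IH: "xt k = ?b - ?M *v q k" "h k = - (?C *v q k)"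
      by auto
    \<comment> \<open>The negative gradient of \<open>\<Phi>\<close> at \<open>q k\<close> is the
      residual \<open>?b - ?M *v q k\<close>, which the induction hypothesis identifies with
      \<open>xt k\<close>. So the claim about \<open>h\<close> needs the one about \<open>xt\<close>
      in the same induction.\<close>
    have q: "q (Suc k) = q k + \<alpha> *\<^sub>R xt k"
      using q_step[OF k] by (simp add: grad IH(1) algebra_simps)
    show ?case
      using IH by (simp add: q xt_step[OF k] h_step[OF k] matrix_vector_right_distrib
          matrix_vector_mult_scaleR)
  qed
  then show ?thesis by simp
qed

end
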